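(* Let $n\in\mathbb{N}$ ($n\ge 1$) and let $X_1,\ldots,X_n$ be independent mean zero random variables with distributions $G_1\in\mathcal{F}_{\sigma_1},\ldots,G_n\in\mathcal{F}_{\sigma_n}$, where $\sigma_1,\dots,\sigma_n\in(0,\infty)$. Let $F_n$ be the distribution function of $$W=\frac{1}{\sigma}\sum_{i=1}^n X_i,\qquad\text{where } \sigma^2=\sum_{i=1}^n\sigma_i^2,\ \sigma>0.$$ Then $$\|F_n-\Phi\|_1\le \frac{1}{\sigma^3}\sum_{i=1}^n E|X_i|^3 .$$ In particular, if $\sigma\in(0,\infty)$ now denotes the common standard deviation of independent, identically distributed $X_1,X_2,\ldots$ with common distribution $G\in\mathcal{F}_\sigma$, and $F_n$ is the distribution function of $(X_1+\cdots+X_n)/(\sigma\sqrt n)$, then $$\|F_n-\Phi\|_1\le\frac{E|X_1|^3}{\sigma^3\sqrt n}\qquad\text{for all } n\in\mathbb{N}.$$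
   Context: For $\sigma\in(0,\infty)$, $\mathcal{F}_\sigma$ is the collection of probability distributions on $\mathbb{R}$ with mean zero, variance $\sigma^2$ and finite absolute third moment. $\Phi$ is the standard normal distribution function. For distribution functions $F,G$ on $\mathbb{R}$, $\|F-G\|_1=\int_{-\infty}^\infty|F(x)-G(x)|\,dx$. *)

theory Defs
  imports "HOL-Probability.Probability"
begin

(* On a probability measure, integrability of the absolute third power gives integrability
   of the identity and its square, so the two integrals below are genuine moments. *)
definition mean_zero_class :: "real \<Rightarrow> real measure set" where
  "mean_zero_class \<sigma> = {G. real_distribution G
     \<and> integrable G (\<lambda>x. \<bar>x\<bar> ^ 3)
     \<and> prob_space.expectation G (\<lambda>x. x) = 0
     \<and> prob_space.variance G (\<lambda>x. x) = \<sigma>\<^sup>2}"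

(* Valued in ennreal: the Bochner integral would be 0 for a non-integrable difference. *)
definition L1_dist :: "(real \<Rightarrow> real) \<Rightarrow> (real \<Rightarrow> real) \<Rightarrow> ennreal" where
  "L1_dist F G = (\<integral>\<^sup>+ x. ennreal \<bar>F x - G x\<bar> \<partial>lborel)"

end

theory Submission
  imports Defs
begin

text \<open>
  Stein's method. For a 1-Lipschitz function \<^term>\<open>h\<close>, the solution \<^term>\<open>g\<close> of the Stein equation
  \<^term>\<open>g' x - x * g x = h x - m\<close>, with \<^term>\<open>m\<close> the Gaussian mean of \<^term>\<open>h\<close>, has a 2-Lipschitz
  derivative. It therefore suffices to bound the expectation of \<^term>\<open>g' W - W * g W\<close>, which by
  independence splits into one term per summand: for a mean zero variable \<^term>\<open>X\<close> with variance
  \<^term>\<open>v\<close> and any \<^term>\<open>g\<close> with \<^term>\<open>L\<close>-Lipschitz derivative, the expectation of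
  \<^term>\<open>v * g' X - X * g X\<close> is at most \<^term>\<open>L / 2\<close> times the third absolute moment of \<^term>\<open>X\<close>.
  This sharp bound replaces the usual zero bias coupling and extreme point argument. Write
  \<^term>\<open>v\<close> as the second moment of an independent copy \<^term>\<open>Y\<close>; after symmetrization and after
  adding \<^term>\<open>X * \<phi> Y + Y * \<phi> X\<close>, which has mean zero, the inequality holds pointwise for a suitable
  \<^term>\<open>\<phi>\<close>. Finally the L1 distance of two distribution functions is the difference of the
  expectations of a single 1-Lipschitz \<^term>\<open>h\<close>, a primitive of the sign of their difference.
\<close>

section \<open>Mean zero variables with a finite third moment\<close>

text \<open>For either sign \<open>c\<close>, the function \<open>c\<close> times the Taylor
  remainder plus \<open>L / 2 * (t - x)^2\<close> has a derivative with the sign of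
  \<open>t - x\<close>, because \<open>c * (k t - k x)\<close> is dominated by
  \<open>L * \<bar>t - x\<bar>\<close>. It is therefore minimal at \<open>t = x\<close>, where it
  vanishes.\<close>

lemma lipschitz_derivative_taylor:
  fixes g k :: "real \<Rightarrow> real"
  assumes g: "\<And>x. (g has_real_derivative k x) (at x)"
    and k: "\<And>x y. \<bar>k x - k y\<bar> \<le> L * \<bar>x - y\<bar>"
  shows "\<bar>g y - g x - k x * (y - x)\<bar> \<le> L / 2 * (y - x)\<^sup>2"
proof -
  have d: "((\<lambda>t. c * (g t - g x - k x * (t - x)) + e * (L / 2 * (t - x)\<^sup>2)) has_real_derivative
        (c * (k t - k x) + e * (L * (t - x)))) (at t)" for c e t
    by (auto intro!: derivative_eq_intros g simp: field_simps)
  have key: "c * (g y - g x - k x * (y - x)) + L / 2 * (y - x)\<^sup>2 \<ge> 0" if c: "\<bar>c\<bar> = 1" for c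
  proof (cases "x \<le> y")
    case True
    have "c * (g x - g x - k x * (x - x)) + 1 * (L / 2 * (x - x)\<^sup>2)
          \<le> c * (g y - g x - k x * (y - x)) + 1 * (L / 2 * (y - x)\<^sup>2)"
    proof (rule DERIV_nonneg_imp_nondecreasing[OF True])
      fix t assume t: "x \<le> t" "t \<le> y"
      have "\<bar>c * (k t - k x)\<bar> \<le> L * (t - x)" using k[of t x] t c by (simp add: abs_mult)
      then show "\<exists>z. ((\<lambda>t. c * (g t - g x - k x * (t - x)) + 1 * (L / 2 * (t - x)\<^sup>2)) has_real_derivative z) (at t) \<and> 0 \<le> z"
        using d[of c 1 t] by (intro exI[of _ "c * (k t - k x) + 1 * (L * (t - x))"]) auto
    qed
    then show ?thesis by simp
  next
    case False
    then have "y \<le> x" by simp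
    have "c * (g y - g x - k x * (y - x)) + 1 * (L / 2 * (y - x)\<^sup>2)
          \<ge> c * (g x - g x - k x * (x - x)) + 1 * (L / 2 * (x - x)\<^sup>2)"
    proof (rule DERIV_nonpos_imp_nonincreasing[OF \<open>y \<le> x\<close>])
      fix t assume t: "y \<le> t" "t \<le> x"
      have "\<bar>c * (k t - k x)\<bar> \<le> L * (x - t)" using k[of t x] t c by (simp add: abs_mult)
      then show "\<exists>z. ((\<lambda>t. c * (g t - g x - k x * (t - x)) + 1 * (L / 2 * (t - x)\<^sup>2)) has_real_derivative z) (at t) \<and> z \<le> 0"
        using d[of c 1 t] by (intro exI[of _ "c * (k t - k x) + 1 * (L * (t - x))"]) (auto simp: algebra_simps)
    qed
    then show ?thesis by simp
  qed
  from key[of 1] key[of "-1"] show ?thesis by (intro abs_leI) simp_all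
qed

text \<open>In both pair inequalities the left-hand side vanishes for constant \<^term>\<open>k\<close>. For opposite
  signs, the interval from \<^term>\<open>- b\<close> to \<^term>\<open>a\<close> is split at \<^term>\<open>a - b\<close>, the point at
  which the optimal transport of the uniform law to the two end points changes target.\<close>

lemma pair_inequality_same_sign:
  fixes g k :: "real \<Rightarrow> real"
  assumes g: "\<And>x. (g has_real_derivative k x) (at x)"
    and k: "\<And>x y. \<bar>k x - k y\<bar> \<le> L * \<bar>x - y\<bar>"
    and xy: "0 \<le> y" "y \<le> x"
  shows "x * k y - y * k x - (g x - g y) \<le> L / 2 * (x\<^sup>2 - y\<^sup>2)"
proof -
  \<comment> \<open>The left-hand side splits into \<open>k y * (x - y) - (g x - g y)\<close> and
    \<open>y * (k y - k x)\<close>; their bounds \<open>L / 2 * (x - y)^2\<close> and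
    \<open>L * y * (x - y)\<close> add up exactly to the right-hand side.\<close>
  have "g x - g y \<ge> k y * (x - y) - L / 2 * (x - y)\<^sup>2"
    using lipschitz_derivative_taylor[OF g k, of x y] by linarith
  moreover have "y * (k y - k x) \<le> y * (L * (x - y))"
    using k[of y x] xy by (intro mult_left_mono) auto
  ultimately show ?thesis by (simp add: field_simps power2_eq_square)
qed

lemma pair_inequality_opposite_sign:
  fixes g k :: "real \<Rightarrow> real"
  assumes g: "\<And>x. (g has_real_derivative k x) (at x)"
    and k: "\<And>x y. \<bar>k x - k y\<bar> \<le> L * \<bar>x - y\<bar>"
  shows "b * k a + a * k (- b) - (g a - g (- b)) \<le> L / 2 * (a\<^sup>2 + b\<^sup>2)"
proof -
  have "g (a - b) - g a - k a * (- b) \<le> L / 2 * b\<^sup>2"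
    using abs_le_D1[OF lipschitz_derivative_taylor[OF g k, of "a - b" a]] by simp
  moreover have "g (a - b) - g (- b) - k (- b) * a \<ge> - (L / 2 * a\<^sup>2)"
    using abs_le_D2[OF lipschitz_derivative_taylor[OF g k, of "a - b" "- b"]] by simp
  ultimately show ?thesis by (simp add: algebra_simps)
qed

text \<open>The terms with \<^term>\<open>\<phi>\<close> integrate to zero against a mean zero law. Equality on the diagonal
  \<^term>\<open>x = y\<close> dictates the choice of \<^term>\<open>\<phi>\<close>.\<close>

lemma pair_inequality:
  fixes g k :: "real \<Rightarrow> real" and L :: real
  assumes g: "\<And>x. (g has_real_derivative k x) (at x)"
    and k: "\<And>x y. \<bar>k x - k y\<bar> \<le> L * \<bar>x - y\<bar>"
  defines "\<phi> \<equiv> \<lambda>x. g x - x * k x + L / 2 * (x * \<bar>x\<bar>)"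
  shows "y\<^sup>2 * k x + x\<^sup>2 * k y - x * g x - y * g y + x * \<phi> y + y * \<phi> x
      \<le> L / 2 * (\<bar>x\<bar> ^ 3 + \<bar>y\<bar> ^ 3)" (is "?P x y")
proof -
  have sym: "?P y x" if "?P x y" for x y using that by (simp add: algebra_simps)
  \<comment> \<open>With \<open>\<phi>\<close> inserted, \<open>?P x y\<close> says that
    \<open>(x - y) * (x * k y - y * k x - (g x - g y))\<close> is at most \<open>L / 2\<close> times
    \<open>\<bar>x\<bar>^3 + \<bar>y\<bar>^3 - x * y * (\<bar>x\<bar> + \<bar>y\<bar>)\<close>. The
    latter factors as \<open>(x - y) * (x^2 - y^2)\<close> for nonnegative arguments and as
    \<open>(x - y) * (x^2 + y^2)\<close> for \<open>y \<le> 0 \<le> x\<close>.\<close>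
  have pos: "?P x y" if "0 \<le> y" "y \<le> x" for x y
  proof -
    have "(x - y) * (x * k y - y * k x - (g x - g y)) \<le> (x - y) * (L / 2 * (x\<^sup>2 - y\<^sup>2))"
      using that by (intro mult_left_mono pair_inequality_same_sign g k) auto
    then show ?thesis using that
      by (simp add: \<phi>_def field_simps power2_eq_square power3_eq_cube)
  qed
  have neg: "?P x y" if "y \<le> 0" "x \<le> y" for x y
  proof -
    \<comment> \<open>Reflection at the origin preserves the hypotheses with the same
      \<open>L\<close> and reduces two nonpositive points to two nonnegative ones.\<close>
    have d: "((\<lambda>x. - g (- x)) has_real_derivative k (- x)) (at x)" for x
      by (auto intro!: derivative_eq_intros DERIV_chain2[OF g])
    have l: "\<bar>k (- x) - k (- y)\<bar> \<le> L * \<bar>x - y\<bar>" for x y using k[of "-x" "-y"] by (simp add: abs_minus_commute)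
    have "(y - x) * (- x * k y + y * k x + (g x - g y)) \<le> (y - x) * (L / 2 * (x\<^sup>2 - y\<^sup>2))"
      using pair_inequality_same_sign[OF d l, of "- y" "- x"] that by (intro mult_left_mono) auto
    then show ?thesis using that
      by (simp add: \<phi>_def field_simps power2_eq_square power3_eq_cube)
  qed
  have opp: "?P x y" if "0 \<le> x" "y \<le> 0" for x y
  proof -
    have "(x - y) * (- y * k x + x * k y - (g x - g y)) \<le> (x - y) * (L / 2 * (x\<^sup>2 + y\<^sup>2))"
      using pair_inequality_opposite_sign[OF g k, of "- y" x] that by (intro mult_left_mono) auto
    then show ?thesis using that
      by (simp add: \<phi>_def field_simps power2_eq_square power3_eq_cube)
  qed
  show ?thesis
    using pos[of x y] pos[of y x] neg[of x y] neg[of y x] opp[of x y] opp[of y x] sym by (meson linear)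
qed

section \<open>Cubic growth and the Stein bound for a single variable\<close>

lemma (in finite_measure) integrable_cubic_growth:
  fixes p X :: "'a \<Rightarrow> real"
  assumes "X \<in> borel_measurable M" "p \<in> borel_measurable M" "integrable M (\<lambda>x. \<bar>X x\<bar> ^ 3)"
    and b: "\<And>x. \<bar>p x\<bar> \<le> C * (1 + \<bar>X x\<bar> ^ 3)"
  shows "integrable M p"
proof (rule Bochner_Integration.integrable_bound)
  show "integrable M (\<lambda>x. C * (1 + \<bar>X x\<bar> ^ 3))" using assms by auto
  show "AE x in M. norm (p x) \<le> norm (C * (1 + \<bar>X x\<bar> ^ 3))"
    using b by (auto intro!: AE_I2 order.trans[OF b])
qed (use assms in auto)

lemma power_le_one_plus_cube:
  fixes t :: real assumes "0 \<le> t" "n \<le> 3" shows "t ^ n \<le> 1 + t ^ 3"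
proof (cases "t \<le> 1")
  case True then show ?thesis using assms power_le_one[of t n] zero_le_power[of t 3] by linarith
next
  case False then show ?thesis using power_increasing[OF assms(2), of t] by linarith
qed

lemma lipschitz_derivative_measurable:
  fixes g k :: "real \<Rightarrow> real"
  assumes g: "\<And>x. (g has_real_derivative k x) (at x)"
    and k: "\<And>x y. \<bar>k x - k y\<bar> \<le> L * \<bar>x - y\<bar>"
  shows "g \<in> borel_measurable borel" "k \<in> borel_measurable borel"
proof -
  have "continuous_on UNIV g" using g by (meson DERIV_isCont continuous_at_imp_continuous_on)
  moreover have "L-lipschitz_on UNIV k"
    using k k[of 1 0] by (auto simp: lipschitz_on_def dist_real_def)
  ultimately show "g \<in> borel_measurable borel" "k \<in> borel_measurable borel"
    by (auto intro: borel_measurable_continuous_onI lipschitz_on_continuous_on)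
qed

text \<open>Taylor expansion at 0 makes \<open>k\<close> grow linearly and \<open>g\<close>
  quadratically. The factor \<open>x\<close> and the argument \<open>w\<close> are kept separate so
  that later \<open>x\<close> can be one summand and \<open>w\<close> the whole sum, both dominated
  by one \<open>z\<close>.\<close>

lemma lipschitz_derivative_growth:
  fixes g k :: "real \<Rightarrow> real"
  assumes g: "\<And>x. (g has_real_derivative k x) (at x)"
    and k: "\<And>x y. \<bar>k x - k y\<bar> \<le> L * \<bar>x - y\<bar>"
  obtains C where "\<And>x w z. \<bar>x\<bar> \<le> z \<Longrightarrow> \<bar>w\<bar> \<le> z \<Longrightarrow>
    \<bar>k w\<bar> \<le> C * (1 + z ^ 3) \<and> \<bar>g w\<bar> \<le> C * (1 + z ^ 3) \<and>
    \<bar>x * k w\<bar> \<le> C * (1 + z ^ 3) \<and> \<bar>x * g w\<bar> \<le> C * (1 + z ^ 3)"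
proof
  fix x w z :: real assume xz: "\<bar>x\<bar> \<le> z" and wz: "\<bar>w\<bar> \<le> z"
  have z: "0 \<le> z" and L: "0 \<le> L" using wz k[of 1 0] by auto
  have le: "a * z ^ n \<le> a * (1 + z ^ 3)" if "n \<le> 3" "0 \<le> a" for a n
    using that z by (intro mult_left_mono power_le_one_plus_cube) auto
  have Lw: "L * \<bar>w\<bar> \<le> L * z" "\<bar>k 0\<bar> * \<bar>w\<bar> \<le> \<bar>k 0\<bar> * z" "L / 2 * w\<^sup>2 \<le> L / 2 * z\<^sup>2"
    using wz L z by (auto intro!: mult_left_mono simp: abs_le_square_iff[symmetric])
  have kw: "\<bar>k w\<bar> \<le> \<bar>k 0\<bar> + L * z" using k[of w 0] Lw by simp
  have gw: "\<bar>g w\<bar> \<le> \<bar>g 0\<bar> + \<bar>k 0\<bar> * z + L / 2 * z\<^sup>2"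
    using lipschitz_derivative_taylor[OF g k, of w 0] abs_mult[of "k 0" w] Lw
    unfolding diff_zero by linarith
  have "\<bar>x * k w\<bar> \<le> z * (\<bar>k 0\<bar> + L * z)"
    unfolding abs_mult using xz kw z by (intro mult_mono) auto
  then have xkw: "\<bar>x * k w\<bar> \<le> \<bar>k 0\<bar> * z + L * z\<^sup>2"
    by (simp add: algebra_simps power2_eq_square)
  have "\<bar>x * g w\<bar> \<le> z * (\<bar>g 0\<bar> + \<bar>k 0\<bar> * z + L / 2 * z\<^sup>2)"
    unfolding abs_mult using xz gw z by (intro mult_mono) auto
  then have xgw: "\<bar>x * g w\<bar> \<le> \<bar>g 0\<bar> * z + \<bar>k 0\<bar> * z\<^sup>2 + L / 2 * z ^ 3"
    by (simp add: algebra_simps power2_eq_square power3_eq_cube)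
  define A B where "A = \<bar>g 0\<bar>" and "B = \<bar>k 0\<bar>"
  have nn: "0 \<le> A" "0 \<le> B" "0 \<le> L / 2" using L by (auto simp: A_def B_def)
  have comb: "a * z ^ l + b * z ^ m + c * z ^ n \<le> (A + B + L) * (1 + z ^ 3)"
    if "a \<le> A" "b \<le> B" "c \<le> L" "l \<le> 3" "m \<le> 3" "n \<le> 3" "0 \<le> a" "0 \<le> b" "0 \<le> c" for a b c l m n
  proof -
    have "a * z ^ l + b * z ^ m + c * z ^ n \<le> a * (1 + z ^ 3) + b * (1 + z ^ 3) + c * (1 + z ^ 3)"
      using that by (intro add_mono le)
    also have "\<dots> = (a + b + c) * (1 + z ^ 3)" by (simp add: algebra_simps)
    also have "\<dots> \<le> (A + B + L) * (1 + z ^ 3)" using that z by (intro mult_right_mono) auto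
    finally show ?thesis .
  qed
  show "\<bar>k w\<bar> \<le> (\<bar>g 0\<bar> + \<bar>k 0\<bar> + L) * (1 + z ^ 3) \<and> \<bar>g w\<bar> \<le> (\<bar>g 0\<bar> + \<bar>k 0\<bar> + L) * (1 + z ^ 3) \<and>
    \<bar>x * k w\<bar> \<le> (\<bar>g 0\<bar> + \<bar>k 0\<bar> + L) * (1 + z ^ 3) \<and> \<bar>x * g w\<bar> \<le> (\<bar>g 0\<bar> + \<bar>k 0\<bar> + L) * (1 + z ^ 3)"
    using order.trans[OF kw[folded B_def]] comb[of 0 B L 0 0 1]
      order.trans[OF gw[folded A_def B_def]] comb[of A B "L / 2" 0 1 2]
      order.trans[OF xkw[folded B_def]] comb[of 0 B L 0 1 2]
      order.trans[OF xgw[folded A_def B_def]] comb[of A B "L / 2" 1 2 3] nn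
    unfolding A_def[symmetric] B_def[symmetric] by auto
qed

lemma stein_bound_mean_zero:
  fixes g k :: "real \<Rightarrow> real"
  assumes G: "real_distribution G" "integrable G (\<lambda>x. \<bar>x\<bar> ^ 3)"
      "(\<integral>x. x \<partial>G) = 0" "(\<integral>x. x\<^sup>2 \<partial>G) = v"
    and g: "\<And>x. (g has_real_derivative k x) (at x)"
    and k: "\<And>x y. \<bar>k x - k y\<bar> \<le> L * \<bar>x - y\<bar>"
  shows "v * (\<integral>x. k x \<partial>G) - (\<integral>x. x * g x \<partial>G) \<le> L / 2 * (\<integral>x. \<bar>x\<bar> ^ 3 \<partial>G)"
proof -
  interpret real_distribution G by fact
  define \<phi> where "\<phi> x = g x - x * k x + L / 2 * (x * \<bar>x\<bar>)" for x
  note [measurable] = lipschitz_derivative_measurable[OF g k]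
  obtain C where C: "\<And>x w z. \<bar>x\<bar> \<le> z \<Longrightarrow> \<bar>w\<bar> \<le> z \<Longrightarrow>
      \<bar>k w\<bar> \<le> C * (1 + z ^ 3) \<and> \<bar>g w\<bar> \<le> C * (1 + z ^ 3) \<and>
      \<bar>x * k w\<bar> \<le> C * (1 + z ^ 3) \<and> \<bar>x * g w\<bar> \<le> C * (1 + z ^ 3)"
    using lipschitz_derivative_growth[OF g k] by metis
  have [simp]: "prob UNIV = 1" using prob_space by simp
  have int: "integrable G p"
    if [measurable]: "p \<in> borel_measurable borel" and "\<And>x. \<bar>p x\<bar> \<le> c * (1 + \<bar>x\<bar> ^ 3)" for p c
    using G that by (intro integrable_cubic_growth[of "\<lambda>x. x" p c]) auto
  have gr: "\<bar>x\<bar> ^ n \<le> 1 + \<bar>x\<bar> ^ 3" if "n \<le> 3" for x :: real and n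
    using that by (intro power_le_one_plus_cube) auto
  have i1: "integrable G (\<lambda>x. x)" using gr[of 1] by (intro int[of _ 1]) auto
  have i2: "integrable G (\<lambda>x. x\<^sup>2)" using gr[of 2] by (intro int[of _ 1]) auto
  have ik: "integrable G k" and ig: "integrable G g"
    and ixk: "integrable G (\<lambda>x. x * k x)" and ixg: "integrable G (\<lambda>x. x * g x)"
    using C by (auto intro!: int[of _ C])
  have ixx: "integrable G (\<lambda>x. x * \<bar>x\<bar>)"
    using gr[of 2] by (intro int[of _ 1]) (auto simp: abs_mult power2_eq_square)
  have i\<phi>: "integrable G \<phi>" unfolding \<phi>_def using ig ixk ixx by auto
  have pw: "y\<^sup>2 * k x + x\<^sup>2 * k y - x * g x - y * g y + x * \<phi> y + y * \<phi> x
      \<le> L / 2 * (\<bar>x\<bar> ^ 3 + \<bar>y\<bar> ^ 3)" for x y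
    unfolding \<phi>_def by (rule pair_inequality[OF g k])
  \<comment> \<open>Integrating over \<open>x\<close> removes \<open>x * \<phi> y\<close>. The later
    integration over \<open>y\<close> removes the remaining \<open>\<phi>\<close> term and yields
    twice the claim.\<close>
  have one: "y\<^sup>2 * (\<integral>x. k x \<partial>G) + v * k y - (\<integral>x. x * g x \<partial>G) - y * g y + y * (\<integral>x. \<phi> x \<partial>G)
      \<le> L / 2 * ((\<integral>x. \<bar>x\<bar> ^ 3 \<partial>G) + \<bar>y\<bar> ^ 3)" for y
  proof -
    have "(\<integral>x. y\<^sup>2 * k x + x\<^sup>2 * k y - x * g x - y * g y + x * \<phi> y + y * \<phi> x \<partial>G)
      \<le> (\<integral>x. L / 2 * (\<bar>x\<bar> ^ 3 + \<bar>y\<bar> ^ 3) \<partial>G)"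
      using i1 i2 ik ixg i\<phi> G(2) by (intro integral_mono pw) auto
    then show ?thesis using i1 i2 ik ixg i\<phi> G(2-4) by (simp add: prob_space)
  qed
  have "(\<integral>y. y\<^sup>2 * (\<integral>x. k x \<partial>G) + v * k y - (\<integral>x. x * g x \<partial>G) - y * g y + y * (\<integral>x. \<phi> x \<partial>G) \<partial>G)
      \<le> (\<integral>y. L / 2 * ((\<integral>x. \<bar>x\<bar> ^ 3 \<partial>G) + \<bar>y\<bar> ^ 3) \<partial>G)"
    using i1 i2 ik ixg G(2) by (intro integral_mono one) auto
  then show ?thesis using i1 i2 ik ixg G(2-4) by (simp add: prob_space)
qed

section \<open>The Stein bound for sums of independent variables\<close>

lemma integrable_abs_add_cube:
  fixes X Y :: "'a \<Rightarrow> real"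
  assumes [measurable]: "X \<in> borel_measurable M" "Y \<in> borel_measurable M"
    and "integrable M (\<lambda>x. \<bar>X x\<bar> ^ 3)" "integrable M (\<lambda>x. \<bar>Y x\<bar> ^ 3)"
  shows "integrable M (\<lambda>x. (\<bar>X x\<bar> + \<bar>Y x\<bar>) ^ 3)"
proof (rule Bochner_Integration.integrable_bound)
  show "integrable M (\<lambda>x. 8 * (\<bar>X x\<bar> ^ 3 + \<bar>Y x\<bar> ^ 3))" using assms by simp
  have "(a + b) ^ 3 \<le> 8 * (a ^ 3 + b ^ 3)" if "0 \<le> a" "0 \<le> b" for a b :: real
  proof -
    have "(a + b) ^ 3 \<le> (2 * max a b) ^ 3" using that by (intro power_mono) auto
    also have "\<dots> = 8 * max a b ^ 3" by (simp add: power_mult_distrib)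
    also have "max a b ^ 3 \<le> a ^ 3 + b ^ 3" using that by (simp add: max_def)
    finally show ?thesis by simp
  qed
  then show "AE x in M. norm ((\<bar>X x\<bar> + \<bar>Y x\<bar>) ^ 3) \<le> norm (8 * (\<bar>X x\<bar> ^ 3 + \<bar>Y x\<bar> ^ 3))"
    by auto
qed measurable

lemma integrable_abs_sum_cube:
  fixes X :: "'i \<Rightarrow> 'a \<Rightarrow> real"
  assumes "finite I" "\<And>i. i \<in> I \<Longrightarrow> X i \<in> borel_measurable M"
    and "\<And>i. i \<in> I \<Longrightarrow> integrable M (\<lambda>x. \<bar>X i x\<bar> ^ 3)"
  shows "integrable M (\<lambda>x. \<bar>\<Sum>i\<in>I. X i x\<bar> ^ 3)"
  using assms
proof (induction I rule: finite_induct)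
  case (insert i I)
  note [measurable] = insert.prems(1)
  have [measurable]: "(\<lambda>x. \<Sum>i\<in>I. X i x) \<in> borel_measurable M"
    using insert.prems by (intro borel_measurable_sum) auto
  have "integrable M (\<lambda>x. (\<bar>X i x\<bar> + \<bar>\<Sum>i\<in>I. X i x\<bar>) ^ 3)"
    using insert by (intro integrable_abs_add_cube) auto
  then have "integrable M (\<lambda>x. \<bar>X i x + (\<Sum>i\<in>I. X i x)\<bar> ^ 3)"
    by (rule Bochner_Integration.integrable_bound)
      (auto intro!: AE_I2 power_mono simp: insert.prems)
  then show ?case using insert by simp
qed simp

text \<open>Independence allows \<open>S\<close> to be frozen at a value \<open>s\<close>. The
  translate of \<open>g\<close> by \<open>s\<close> has a derivative with the same constant
  \<open>L\<close>, so the bound for a single variable holds uniformly in \<open>s\<close> and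
  survives integration over the law of \<open>S\<close>.\<close>

lemma (in prob_space) stein_bound_summand:
  fixes X S :: "'a \<Rightarrow> real" and g k :: "real \<Rightarrow> real"
  assumes indep: "indep_var borel X borel S"
    and X: "integrable M (\<lambda>x. \<bar>X x\<bar> ^ 3)" "expectation X = 0" "expectation (\<lambda>x. (X x)\<^sup>2) = v"
    and S: "integrable M (\<lambda>x. \<bar>S x\<bar> ^ 3)"
    and g: "\<And>x. (g has_real_derivative k x) (at x)"
    and k: "\<And>x y. \<bar>k x - k y\<bar> \<le> L * \<bar>x - y\<bar>"
  shows "integrable M (\<lambda>x. k (X x + S x))" "integrable M (\<lambda>x. X x * g (X x + S x))"
    "v * expectation (\<lambda>x. k (X x + S x)) - expectation (\<lambda>x. X x * g (X x + S x))
      \<le> L / 2 * expectation (\<lambda>x. \<bar>X x\<bar> ^ 3)"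
proof -
  note [measurable] = lipschitz_derivative_measurable[OF g k]
    indep_var_rv1[OF indep] indep_var_rv2[OF indep]
  obtain C where C: "\<And>x w z. \<bar>x\<bar> \<le> z \<Longrightarrow> \<bar>w\<bar> \<le> z \<Longrightarrow>
      \<bar>k w\<bar> \<le> C * (1 + z ^ 3) \<and> \<bar>g w\<bar> \<le> C * (1 + z ^ 3) \<and>
      \<bar>x * k w\<bar> \<le> C * (1 + z ^ 3) \<and> \<bar>x * g w\<bar> \<le> C * (1 + z ^ 3)"
    using lipschitz_derivative_growth[OF g k] by metis
  have Z: "integrable M (\<lambda>x. \<bar>\<bar>X x\<bar> + \<bar>S x\<bar>\<bar> ^ 3)"
    using integrable_abs_add_cube[OF _ _ X(1) S] by simp
  show ik: "integrable M (\<lambda>x. k (X x + S x))" and ig: "integrable M (\<lambda>x. X x * g (X x + S x))"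
    using C[of "X x" "\<bar>X x\<bar> + \<bar>S x\<bar>" "X x + S x" for x]
    by (auto intro!: integrable_cubic_growth[OF _ _ Z, of _ C])
  define G where "G = distr M borel X"
  define H where "H = distr M borel S"
  interpret G: real_distribution G unfolding G_def by simp
  interpret H: real_distribution H unfolding H_def by simp
  interpret GH: pair_prob_space G H ..
  have joint: "G \<Otimes>\<^sub>M H = distr M (borel \<Otimes>\<^sub>M borel) (\<lambda>x. (X x, S x))"
    using indep unfolding indep_var_distribution_eq G_def H_def by simp
  define p where "p = (\<lambda>(x, s). v * k (x + s) - x * g (x + s))"
  have p[measurable]: "p \<in> borel_measurable (borel \<Otimes>\<^sub>M borel)" unfolding p_def by measurable
  have ip: "integrable (G \<Otimes>\<^sub>M H) p"
    unfolding joint using ik ig by (subst integrable_distr_eq) (auto simp: p_def)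
  have mG: "integrable G (\<lambda>x. \<bar>x\<bar> ^ 3)" "(\<integral>x. x \<partial>G) = 0" "(\<integral>x. x\<^sup>2 \<partial>G) = v"
    and cG: "(\<integral>x. \<bar>x\<bar> ^ 3 \<partial>G) = expectation (\<lambda>x. \<bar>X x\<bar> ^ 3)"
    using X by (simp_all add: G_def integrable_distr_eq integral_distr)
  have inner: "(\<integral>x. p (x, s) \<partial>G) \<le> L / 2 * expectation (\<lambda>x. \<bar>X x\<bar> ^ 3)" for s
  proof -
    have g': "((\<lambda>x. g (x + s)) has_real_derivative k (x + s)) (at x)" for x
      using g[of "x + s"] by (simp add: DERIV_shift)
    have k': "\<bar>k (x + s) - k (y + s)\<bar> \<le> L * \<bar>x - y\<bar>" for x y using k[of "x + s" "y + s"] by simp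
    obtain D where D: "\<And>x w z. \<bar>x\<bar> \<le> z \<Longrightarrow> \<bar>w\<bar> \<le> z \<Longrightarrow>
      \<bar>k (w + s)\<bar> \<le> D * (1 + z ^ 3) \<and> \<bar>g (w + s)\<bar> \<le> D * (1 + z ^ 3) \<and>
      \<bar>x * k (w + s)\<bar> \<le> D * (1 + z ^ 3) \<and> \<bar>x * g (w + s)\<bar> \<le> D * (1 + z ^ 3)"
      using lipschitz_derivative_growth[OF g' k'] by metis
    have "integrable G (\<lambda>x. k (x + s))" "integrable G (\<lambda>x. x * g (x + s))"
      using D by (auto intro!: G.integrable_cubic_growth[OF _ _ mG(1), of _ D])
    then show ?thesis
      using stein_bound_mean_zero[OF G.real_distribution_axioms mG g' k'] cG
      by (simp add: p_def)
  qed
  have "v * expectation (\<lambda>x. k (X x + S x)) - expectation (\<lambda>x. X x * g (X x + S x))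
      = expectation (\<lambda>x. p (X x, S x))"
    using ik ig by (simp add: p_def)
  also have "\<dots> = (\<integral>z. p z \<partial>(G \<Otimes>\<^sub>M H))" unfolding joint by (simp add: integral_distr)
  also have "\<dots> = (\<integral>s. (\<integral>x. p (x, s) \<partial>G) \<partial>H)"
    using GH.integral_snd[of "\<lambda>x s. p (x, s)"] ip by simp
  also have "\<dots> \<le> (\<integral>s. L / 2 * expectation (\<lambda>x. \<bar>X x\<bar> ^ 3) \<partial>H)"
    using GH.integrable_snd[of "\<lambda>x s. p (x, s)"] ip inner by (intro integral_mono) auto
  also have "\<dots> = L / 2 * expectation (\<lambda>x. \<bar>X x\<bar> ^ 3)"
    using H.prob_space by simp
  finally show "v * expectation (\<lambda>x. k (X x + S x)) - expectation (\<lambda>x. X x * g (X x + S x))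
      \<le> L / 2 * expectation (\<lambda>x. \<bar>X x\<bar> ^ 3)" .
qed

lemma (in prob_space) stein_bound_sum:
  fixes X :: "'i \<Rightarrow> 'a \<Rightarrow> real" and g k :: "real \<Rightarrow> real"
  assumes I: "finite I" and indep: "indep_vars (\<lambda>_. borel) X I"
    and X: "\<And>i. i \<in> I \<Longrightarrow> integrable M (\<lambda>x. \<bar>X i x\<bar> ^ 3)" "\<And>i. i \<in> I \<Longrightarrow> expectation (X i) = 0"
    and var: "(\<Sum>i\<in>I. expectation (\<lambda>x. (X i x)\<^sup>2)) = 1"
    and g: "\<And>x. (g has_real_derivative k x) (at x)"
    and k: "\<And>x y. \<bar>k x - k y\<bar> \<le> L * \<bar>x - y\<bar>"
  defines "W \<equiv> \<lambda>x. \<Sum>i\<in>I. X i x"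
  shows "expectation (\<lambda>x. k (W x) - W x * g (W x)) \<le> L / 2 * (\<Sum>i\<in>I. expectation (\<lambda>x. \<bar>X i x\<bar> ^ 3))"
proof -
  have rv: "X i \<in> borel_measurable M" if "i \<in> I" for i
    using indep that unfolding indep_vars_def by blast
  define v where "v i = expectation (\<lambda>x. (X i x)\<^sup>2)" for i
  have W: "W x = X i x + (\<Sum>j\<in>I - {i}. X j x)" if "i \<in> I" for i x
    unfolding W_def using I that by (simp add: sum.remove)
  have ind: "indep_var borel (X i) borel (\<lambda>x. \<Sum>j\<in>I - {i}. X j x)" if "i \<in> I" for i
    using that I indep by (intro indep_vars_sum) (auto simp: insert_absorb)
  have S: "integrable M (\<lambda>x. \<bar>\<Sum>j\<in>I - {i}. X j x\<bar> ^ 3)" for i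
    using I X rv by (intro integrable_abs_sum_cube) auto
  have *: "integrable M (\<lambda>x. k (W x))" "integrable M (\<lambda>x. X i x * g (W x))"
      "v i * expectation (\<lambda>x. k (W x)) - expectation (\<lambda>x. X i x * g (W x))
      \<le> L / 2 * expectation (\<lambda>x. \<bar>X i x\<bar> ^ 3)" if "i \<in> I" for i
    unfolding W[OF that]
    by (rule stein_bound_summand[OF ind X(1) X(2) v_def[symmetric] S g k]; fact that)+
  \<comment> \<open>Integrability of \<open>k (W x)\<close> is obtained from an arbitrary summand,
    so one must exist.\<close>
  have "I \<noteq> {}" using var by auto
  then have ik: "integrable M (\<lambda>x. k (W x))" using *(1) by blast
  have iX: "integrable M (\<lambda>x. X i x * g (W x))" if "i \<in> I" for i using *(2) that by blast
  have "expectation (\<lambda>x. k (W x) - W x * g (W x))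
      = expectation (\<lambda>x. k (W x) - (\<Sum>i\<in>I. X i x * g (W x)))"
    by (subst (2) W_def) (simp add: sum_distrib_right)
  also have "\<dots> = expectation (\<lambda>x. k (W x)) - (\<Sum>i\<in>I. expectation (\<lambda>x. X i x * g (W x)))"
    using ik iX by simp
  \<comment> \<open>The variances \<open>v i\<close> add up to 1, so they distribute the expectation
    of \<open>k (W x)\<close> over the summands.\<close>
  also have "\<dots> = (\<Sum>i\<in>I. v i * expectation (\<lambda>x. k (W x)) - expectation (\<lambda>x. X i x * g (W x)))"
    using var by (simp add: sum_subtractf v_def flip: sum_distrib_right)
  also have "\<dots> \<le> (\<Sum>i\<in>I. L / 2 * expectation (\<lambda>x. \<bar>X i x\<bar> ^ 3))"
    using *(3) by (intro sum_mono) auto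
  finally show ?thesis by (simp add: sum_distrib_left)
qed

section \<open>The Stein equation\<close>

lemma std_normal_density_has_derivative:
  "(std_normal_density has_real_derivative - x * std_normal_density x) (at x)"
  unfolding std_normal_density_def
  by (auto intro!: derivative_eq_intros simp: field_simps)

lemma std_normal_density_continuous [continuous_intros]:
  "continuous_on S std_normal_density"
  using std_normal_density_has_derivative
  by (meson DERIV_isCont continuous_at_imp_continuous_on)

lemma set_integrable_of_integrable:
  fixes p :: "real \<Rightarrow> real"
  assumes "integrable lborel p" "A \<in> sets borel"
  shows "set_integrable lborel A p"
  using assms unfolding set_integrable_def by (intro integrable_mult_indicator) auto

lemma integral_split_at:
  fixes p :: "real \<Rightarrow> real"
  assumes "integrable lborel p"
  shows "(LBINT x:{..w}. p x) + (LBINT x:{w<..}. p x) = (LBINT x. p x)"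
proof -
  have "(LBINT x:{..w} \<union> {w<..}. p x) = (LBINT x:{..w}. p x) + (LBINT x:{w<..}. p x)"
    using assms by (intro set_integral_Un set_integrable_of_integrable) auto
  moreover have "{..w} \<union> {w<..} = UNIV" by auto
  ultimately show ?thesis by (simp add: set_lebesgue_integral_def)
qed

text \<open>Since the density \<open>\<phi>\<close> satisfies
  \<open>\<phi>' x = - x * \<phi> x\<close>, primitives of \<open>\<phi> x * x\<close> and of
  \<open>\<phi> x * x^2 - \<phi> x\<close> are \<open>- \<phi> x\<close> and
  \<open>- (x * \<phi> x)\<close>; both vanish at infinity.\<close>

lemma std_normal_integral_Ioi:
  "(LBINT x:{w<..}. std_normal_density x * x) = std_normal_density w"
  "(LBINT x:{w<..}. std_normal_density x * x\<^sup>2)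
    = w * std_normal_density w + (LBINT x:{w<..}. std_normal_density x)"
proof -
  let ?\<phi> = std_normal_density
  have i: "set_integrable lborel {w<..} (\<lambda>x. ?\<phi> x * x ^ n)" for n
    using integrable_std_normal_moment by (intro set_integrable_of_integrable) auto
  have einf: "einterval (ereal w) \<infinity> = {w<..}" by (auto simp: einterval_def)
  have lb: "(LBINT x=ereal w..\<infinity>. p x) = (LBINT x:{w<..}. p x)" for p :: "real \<Rightarrow> real"
    by (simp add: interval_lebesgue_integral_def einf)
  have c: "isCont ?\<phi> x" for x using std_normal_density_has_derivative DERIV_isCont by blast
  have l0: "(?\<phi> \<longlongrightarrow> 0) at_top" unfolding std_normal_density_def by real_asymp
  have l1: "((\<lambda>x. x * ?\<phi> x) \<longlongrightarrow> 0) at_top" unfolding std_normal_density_def by real_asymp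
  have "(LBINT x=ereal w..\<infinity>. ?\<phi> x * x) = 0 - (- ?\<phi> w)"
  proof (rule interval_integral_FTC_integrable[where F="\<lambda>x. - ?\<phi> x"])
    show "((\<lambda>x. - ?\<phi> x) has_vector_derivative ?\<phi> x * x) (at x)" for x
      unfolding has_real_derivative_iff_has_vector_derivative[symmetric]
      by (auto intro!: derivative_eq_intros std_normal_density_has_derivative)
    show "set_integrable lborel (einterval (ereal w) \<infinity>) (\<lambda>x. ?\<phi> x * x)"
      using i[of 1] by (simp add: einf)
    show "(((\<lambda>x. - ?\<phi> x) \<circ> real_of_ereal) \<longlongrightarrow> - ?\<phi> w) (at_right (ereal w))"
      using c[of w] by (simp add: ereal_tendsto_simps) (auto intro!: tendsto_intros simp: isCont_def filterlim_at_split)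
    show "(((\<lambda>x. - ?\<phi> x) \<circ> real_of_ereal) \<longlongrightarrow> 0) (at_left \<infinity>)"
      using tendsto_minus[OF l0] by (simp add: ereal_tendsto_simps)
  qed (auto intro!: continuous_intros c)
  then show "(LBINT x:{w<..}. ?\<phi> x * x) = ?\<phi> w" by (simp add: lb)
  have "(LBINT x=ereal w..\<infinity>. ?\<phi> x * x\<^sup>2 - ?\<phi> x) = 0 - (- (w * ?\<phi> w))"
  proof (rule interval_integral_FTC_integrable[where F="\<lambda>x. - (x * ?\<phi> x)"])
    show "((\<lambda>x. - (x * ?\<phi> x)) has_vector_derivative ?\<phi> x * x\<^sup>2 - ?\<phi> x) (at x)" for x
      unfolding has_real_derivative_iff_has_vector_derivative[symmetric]
      by (auto intro!: derivative_eq_intros std_normal_density_has_derivative simp: power2_eq_square)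
    show "set_integrable lborel (einterval (ereal w) \<infinity>) (\<lambda>x. ?\<phi> x * x\<^sup>2 - ?\<phi> x)"
      using i[of 2] i[of 0] by (intro set_integral_diff) (auto simp: einf)
    show "(((\<lambda>x. - (x * ?\<phi> x)) \<circ> real_of_ereal) \<longlongrightarrow> - (w * ?\<phi> w)) (at_right (ereal w))"
      using c[of w] by (simp add: ereal_tendsto_simps) (auto intro!: tendsto_intros simp: isCont_def filterlim_at_split)
    show "(((\<lambda>x. - (x * ?\<phi> x)) \<circ> real_of_ereal) \<longlongrightarrow> 0) (at_left \<infinity>)"
      using tendsto_minus[OF l1] by (simp add: ereal_tendsto_simps)
  qed (auto intro!: continuous_intros c)
  then show "(LBINT x:{w<..}. ?\<phi> x * x\<^sup>2) = w * ?\<phi> w + (LBINT x:{w<..}. ?\<phi> x)"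
    using i[of 2] i[of 0] by (simp add: lb set_integral_diff)
qed

text \<open>These are the complements of the right half-line integrals in the full moments 1, 0 and
  1 of orders 0, 1 and 2.\<close>

lemma std_normal_integral_Iic:
  "(LBINT x:{..w}. std_normal_density x * x) = - std_normal_density w"
  "(LBINT x:{..w}. std_normal_density x * x\<^sup>2)
    = - w * std_normal_density w + (LBINT x:{..w}. std_normal_density x)"
  "(LBINT x:{..w}. std_normal_density x) = 1 - (LBINT x:{w<..}. std_normal_density x)"
proof -
  note split = integral_split_at[OF integrable_std_normal_moment, where w=w]
  show "(LBINT x:{..w}. std_normal_density x * x) = - std_normal_density w"
    using split[of 1] integral_std_normal_moment_odd[of 0] std_normal_integral_Ioi(1)[of w]
    unfolding power_one_right mult_0_right add_0 by linarith
  show P: "(LBINT x:{..w}. std_normal_density x) = 1 - (LBINT x:{w<..}. std_normal_density x)"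
    using split[of 0] integral_std_normal_moment_even[of 0]
    unfolding mult_0_right power_0 mult_1_right fact_0 div_by_1 by linarith
  show "(LBINT x:{..w}. std_normal_density x * x\<^sup>2)
    = - w * std_normal_density w + (LBINT x:{..w}. std_normal_density x)"
    using split[of 2] integral_std_normal_moment_even[of 1] std_normal_integral_Ioi(2)[of w] P
    unfolding mult_1_right power_one_right fact_2 fact_1 by linarith
qed

lemma has_derivative_integral_Iic:
  fixes p :: "real \<Rightarrow> real"
  assumes p: "continuous_on UNIV p" "integrable lborel p"
  shows "((\<lambda>w. LBINT x:{..w}. p x) has_real_derivative p w) (at w)"
proof -
  \<comment> \<open>Cutting at \<open>w - 1\<close> leaves a constant plus an integral over a
    compact interval, to which the fundamental theorem applies near \<open>w\<close>.\<close>
  have eq: "(LBINT x:{..u}. p x) = (LBINT x:{..w - 1}. p x) + integral {w - 1..u} p"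
    if "w - 1 \<le> u" for u
  proof -
    have "(LBINT x:{..w - 1} \<union> {w - 1<..u}. p x) = (LBINT x:{..w - 1}. p x) + (LBINT x:{w - 1<..u}. p x)"
      using p by (intro set_integral_Un set_integrable_of_integrable) auto
    moreover have "{..w - 1} \<union> {w - 1<..u} = {..u}" using that by auto
    moreover have "(LBINT x:{w - 1<..u}. p x) = integral {w - 1<..u} p"
      using p by (intro set_borel_integral_eq_integral set_integrable_of_integrable) auto
    moreover have "integral {w - 1<..u} p = integral {w - 1..u} p"
      by (rule integral_spike_set) (rule negligible_subset[of "{w - 1}"]; force)+
    ultimately show ?thesis by simp
  qed
  have "((\<lambda>u. (LBINT x:{..w - 1}. p x) + integral {w - 1..u} p) has_real_derivative p w) (at w within {w - 1..w + 1})"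
    using integral_has_real_derivative[of "w - 1" "w + 1" p w] continuous_on_subset[OF p(1)]
    by (auto intro!: derivative_eq_intros)
  then have "((\<lambda>u. (LBINT x:{..w - 1}. p x) + integral {w - 1..u} p) has_real_derivative p w) (at w)"
    by (simp add: at_within_Icc_at)
  then show ?thesis
    by (rule has_field_derivative_transform_within_open[where S="{w - 1<..}"]) (auto simp: eq[symmetric])
qed

section \<open>Lipschitz test functions and the solution of the Stein equation\<close>

lemma integrable_std_normal_lipschitz:
  fixes h :: "real \<Rightarrow> real"
  assumes h: "\<And>x y. \<bar>h x - h y\<bar> \<le> \<bar>x - y\<bar>"
  shows "continuous_on S h" "integrable lborel (\<lambda>x. std_normal_density x * h x)"
proof -
  have "1-lipschitz_on UNIV h" using h by (auto simp: lipschitz_on_def dist_real_def)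
  then have c: "continuous_on UNIV h" using lipschitz_on_continuous_on by blast
  then show "continuous_on S h" using continuous_on_subset by blast
  from c have [measurable]: "h \<in> borel_measurable borel" by (rule borel_measurable_continuous_onI)
  show "integrable lborel (\<lambda>x. std_normal_density x * h x)"
  proof (rule Bochner_Integration.integrable_bound)
    show "integrable lborel (\<lambda>x. std_normal_density x * \<bar>x\<bar> ^ 0 * \<bar>h 0\<bar> + std_normal_density x * \<bar>x\<bar> ^ 1)"
      using integrable_std_normal_moment_abs[of 0] integrable_std_normal_moment_abs[of 1]
      by (intro Bochner_Integration.integrable_add integrable_mult_left)
    have "\<bar>h x\<bar> \<le> \<bar>h 0\<bar> + \<bar>x\<bar>" for x using h[of x 0] by simp
    then have "std_normal_density x * \<bar>h x\<bar> \<le> std_normal_density x * (\<bar>h 0\<bar> + \<bar>x\<bar>)" for x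
      by (intro mult_left_mono) auto
    then show "AE x in lborel. norm (std_normal_density x * h x)
        \<le> norm (std_normal_density x * \<bar>x\<bar> ^ 0 * \<bar>h 0\<bar> + std_normal_density x * \<bar>x\<bar> ^ 1)"
      by (auto simp: abs_mult distrib_left)
  qed measurable
qed

text \<open>Writing \<^term>\<open>\<phi>\<close> for the normal density and \<^term>\<open>Z\<close> for a standard normal variable, the
  quantity to be bounded equals \<^term>\<open>(A * a - B * b) / \<phi> w\<close>, where \<^term>\<open>a\<close> and \<^term>\<open>b\<close> are the
  integrals of \<^term>\<open>\<phi> x * (h x - h w)\<close> to the left and to the right of \<^term>\<open>w\<close>. The coefficients
  \<^term>\<open>A\<close> and \<^term>\<open>B\<close> are the second moments of the positive and negative parts of \<^term>\<open>Z - w\<close>,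
  hence nonnegative, so the worst case is \<^term>\<open>\<bar>h x - h w\<bar> = \<bar>x - w\<bar>\<close>.\<close>

lemma stein_solution_bound:
  fixes h :: "real \<Rightarrow> real" and w :: real
  assumes h: "\<And>x y. \<bar>h x - h y\<bar> \<le> \<bar>x - y\<bar>"
  defines "m \<equiv> LBINT x. std_normal_density x * h x"
  shows "\<bar>(1 + w\<^sup>2) * ((LBINT x:{..w}. std_normal_density x * (h x - m)) / std_normal_density w)
      + w * (h w - m)\<bar> \<le> 1"
proof -
  define f where "f = std_normal_density w"
  define P where "P = (LBINT x:{..w}. std_normal_density x)"
  define Q where "Q = (LBINT x:{w<..}. std_normal_density x)"
  define a where "a = (LBINT x:{..w}. std_normal_density x * (h x - h w))"
  define b where "b = (LBINT x:{w<..}. std_normal_density x * (h x - h w))"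
  have f: "0 < f" by (simp add: f_def normal_density_pos)
  have PQ: "P = 1 - Q" unfolding P_def Q_def by (rule std_normal_integral_Iic)
  have i: "integrable lborel (\<lambda>x. std_normal_density x * x ^ n)" for n
    by (rule integrable_std_normal_moment)
  have si: "set_integrable lborel A std_normal_density"
      "set_integrable lborel A (\<lambda>x. std_normal_density x * x)"
      "set_integrable lborel A (\<lambda>x. std_normal_density x * x\<^sup>2)"
      "set_integrable lborel A (\<lambda>x. std_normal_density x * h x)"
    if "A \<in> sets borel" for A
    using set_integrable_of_integrable[OF i that, of 0] set_integrable_of_integrable[OF i that, of 1]
      set_integrable_of_integrable[OF i that, of 2]
      set_integrable_of_integrable[OF integrable_std_normal_lipschitz(2)[OF h] that] by auto
  have lin: "set_integrable lborel A (\<lambda>x. std_normal_density x * (c * h x + d))"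
      "(LBINT x:A. std_normal_density x * (c * h x + d))
        = c * (LBINT x:A. std_normal_density x * h x) + d * (LBINT x:A. std_normal_density x)"
    if "A \<in> sets borel" for A c d
  proof -
    have e: "std_normal_density x * (c * h x + d) = c * (std_normal_density x * h x) + d * std_normal_density x" for x
      by (simp add: algebra_simps)
    show "set_integrable lborel A (\<lambda>x. std_normal_density x * (c * h x + d))"
      unfolding e using si[OF that] by (intro set_integral_add(1) set_integrable_mult_right) auto
    show "(LBINT x:A. std_normal_density x * (c * h x + d))
        = c * (LBINT x:A. std_normal_density x * h x) + d * (LBINT x:A. std_normal_density x)"
      unfolding e using si[OF that]
      by (subst set_integral_add(2)) (auto intro!: set_integrable_mult_right)
  qed
  have quad: "(LBINT x:A. std_normal_density x * (c * x\<^sup>2 + d * x + e))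
        = c * (LBINT x:A. std_normal_density x * x\<^sup>2) + d * (LBINT x:A. std_normal_density x * x)
          + e * (LBINT x:A. std_normal_density x)"
      "set_integrable lborel A (\<lambda>x. std_normal_density x * (c * x\<^sup>2 + d * x + e))"
    if "A \<in> sets borel" for A c d e
  proof -
    have eq: "std_normal_density x * (c * x\<^sup>2 + d * x + e) =
        c * (std_normal_density x * x\<^sup>2) + (d * (std_normal_density x * x) + e * std_normal_density x)" for x
      by (simp add: algebra_simps)
    show "set_integrable lborel A (\<lambda>x. std_normal_density x * (c * x\<^sup>2 + d * x + e))"
      unfolding eq using si[OF that] by (intro set_integral_add(1) set_integrable_mult_right) auto
    show "(LBINT x:A. std_normal_density x * (c * x\<^sup>2 + d * x + e))
        = c * (LBINT x:A. std_normal_density x * x\<^sup>2) + d * (LBINT x:A. std_normal_density x * x)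
          + e * (LBINT x:A. std_normal_density x)"
      unfolding eq using si[OF that]
      by (simp add: set_integral_add set_integrable_mult_right)
  qed
  have quadQ: "(LBINT x:{w<..}. std_normal_density x * (c * x\<^sup>2 + d * x + e))
      = c * (w * f + Q) + d * f + e * Q" for c d e
    by (subst quad) (simp_all only: std_normal_integral_Ioi Q_def f_def borel_open open_greaterThan)
  have quadP: "(LBINT x:{..w}. std_normal_density x * (c * x\<^sup>2 + d * x + e))
      = c * (- w * f + P) + d * (- f) + e * P" for c d e
    by (subst quad) (simp_all only: std_normal_integral_Iic(1,2) P_def f_def borel_closed closed_atMost)
  have h1: "h x - c = 1 * h x + - c" for x c by simp
  have m: "m = a + b + h w"
  proof -
    have "m = (LBINT x:{..w}. std_normal_density x * h x) + (LBINT x:{w<..}. std_normal_density x * h x)"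
      unfolding m_def using integral_split_at[OF integrable_std_normal_lipschitz(2)[OF h]] by simp
    moreover have "a = (LBINT x:{..w}. std_normal_density x * h x) - h w * P"
      unfolding a_def h1 P_def by (subst lin) auto
    moreover have "b = (LBINT x:{w<..}. std_normal_density x * h x) - h w * Q"
      unfolding b_def h1 Q_def by (subst lin) auto
    ultimately show ?thesis using PQ by (simp add: algebra_simps)
  qed
  have U: "(LBINT x:{..w}. std_normal_density x * (h x - m)) = Q * a - P * b"
  proof -
    have "(LBINT x:{..w}. std_normal_density x * (h x - m)) = a + (h w - m) * P"
      unfolding a_def h1 P_def by (subst (1 2) lin) (auto simp: algebra_simps)
    also have "\<dots> = Q * a - P * b" unfolding m PQ by (simp add: algebra_simps)
    finally show ?thesis .
  qed
  \<comment> \<open>Squares and absolute values are written out as explicit quadratics, with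
    coefficients 0 and 1 kept, so that \<open>quadQ\<close> and \<open>quadP\<close> evaluate their
    integrals.\<close>
  have sq: "1 * x\<^sup>2 + (- 2 * w) * x + w\<^sup>2 = (x - w)\<^sup>2" for x
    by (simp add: power2_eq_square algebra_simps)
  have "0 \<le> (LBINT x:{w<..}. std_normal_density x * (1 * x\<^sup>2 + (- 2 * w) * x + w\<^sup>2))"
    unfolding set_lebesgue_integral_def sq by (intro Bochner_Integration.integral_nonneg) auto
  then have A: "0 \<le> (1 + w\<^sup>2) * Q - w * f"
    unfolding quadQ by (simp add: algebra_simps)
  have "0 \<le> (LBINT x:{..w}. std_normal_density x * (1 * x\<^sup>2 + (- 2 * w) * x + w\<^sup>2))"
    unfolding set_lebesgue_integral_def sq by (intro Bochner_Integration.integral_nonneg) auto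
  then have B: "0 \<le> (1 + w\<^sup>2) * P + w * f"
    unfolding quadP by (simp add: algebra_simps)
  have hb: "set_integrable lborel A (\<lambda>x. std_normal_density x * (h x - h w))" if "A \<in> sets borel" for A
    unfolding h1 by (rule lin[OF that])
  have "\<bar>a\<bar> \<le> (LBINT x:{..w}. std_normal_density x * (0 * x\<^sup>2 + (- 1) * x + w))"
    unfolding a_def
  proof (rule order.trans[OF set_integral_norm_bound[OF hb, simplified real_norm_def]])
    show "(LBINT x:{..w}. \<bar>std_normal_density x * (h x - h w)\<bar>)
        \<le> (LBINT x:{..w}. std_normal_density x * (0 * x\<^sup>2 + (- 1) * x + w))"
    proof (intro set_integral_mono set_integrable_abs hb quad(2))
      fix x assume "x \<in> {..w}"
      then have "\<bar>h x - h w\<bar> \<le> 0 * x\<^sup>2 + (- 1) * x + w" using h[of x w] by simp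
      then show "\<bar>std_normal_density x * (h x - h w)\<bar> \<le> std_normal_density x * (0 * x\<^sup>2 + (- 1) * x + w)"
        unfolding abs_mult by (simp only: abs_of_nonneg normal_density_nonneg mult_left_mono)
    qed auto
  qed simp
  then have a: "\<bar>a\<bar> \<le> w * P + f"
    unfolding quadP by simp
  have "\<bar>b\<bar> \<le> (LBINT x:{w<..}. std_normal_density x * (0 * x\<^sup>2 + 1 * x + - w))"
    unfolding b_def
  proof (rule order.trans[OF set_integral_norm_bound[OF hb, simplified real_norm_def]])
    show "(LBINT x:{w<..}. \<bar>std_normal_density x * (h x - h w)\<bar>)
        \<le> (LBINT x:{w<..}. std_normal_density x * (0 * x\<^sup>2 + 1 * x + - w))"
    proof (intro set_integral_mono set_integrable_abs hb quad(2))
      fix x assume "x \<in> {w<..}"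
      then have "\<bar>h x - h w\<bar> \<le> 0 * x\<^sup>2 + 1 * x + - w" using h[of x w] by simp
      then show "\<bar>std_normal_density x * (h x - h w)\<bar> \<le> std_normal_density x * (0 * x\<^sup>2 + 1 * x + - w)"
        unfolding abs_mult by (simp only: abs_of_nonneg normal_density_nonneg mult_left_mono)
    qed auto
  qed simp
  then have b: "\<bar>b\<bar> \<le> f - w * Q"
    unfolding quadQ by simp
  let ?q = "(1 + w\<^sup>2) * ((Q * a - P * b) / f) + w * (h w - m)"
  have "f * ?q = (1 + w\<^sup>2) * (Q * a - P * b) + f * (w * (h w - m))"
    using f by (simp add: distrib_left)
  also have "\<dots> = ((1 + w\<^sup>2) * Q - w * f) * a - ((1 + w\<^sup>2) * P + w * f) * b"
    unfolding m by (simp add: algebra_simps)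
  finally have "\<bar>f * ?q\<bar> \<le> ((1 + w\<^sup>2) * Q - w * f) * \<bar>a\<bar> + ((1 + w\<^sup>2) * P + w * f) * \<bar>b\<bar>"
    using A B abs_triangle_ineq4[of "((1 + w\<^sup>2) * Q - w * f) * a" "((1 + w\<^sup>2) * P + w * f) * b"]
    by (simp only: abs_mult abs_of_nonneg)
  also have "\<dots> \<le> ((1 + w\<^sup>2) * Q - w * f) * (w * P + f) + ((1 + w\<^sup>2) * P + w * f) * (f - w * Q)"
    using A B a b by (intro add_mono mult_left_mono) auto
  \<comment> \<open>The terms in \<open>P * Q\<close> and in \<open>f^2\<close> cancel, and
    \<open>P + Q = 1\<close> reduces the rest to \<open>(1 + w^2) * f - w^2 * f\<close>.\<close>
  also have "\<dots> = f * 1" unfolding PQ by (simp add: algebra_simps power2_eq_square)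
  finally have "\<bar>?q\<bar> \<le> 1" using f by (simp add: abs_mult)
  then show ?thesis unfolding U f_def .
qed

text \<open>The normal density is an integrating factor: its product with \<open>g\<close> has
  derivative density times \<open>h - m\<close>. The constant 2 is 1 from \<open>h\<close> itself
  plus 1 from \<open>w * g w\<close>.\<close>

lemma stein_equation_lipschitz:
  fixes h :: "real \<Rightarrow> real"
  assumes h: "\<And>x y. \<bar>h x - h y\<bar> \<le> \<bar>x - y\<bar>"
  obtains g k :: "real \<Rightarrow> real" where
    "\<And>x. (g has_real_derivative k x) (at x)"
    "\<And>x y. \<bar>k x - k y\<bar> \<le> 2 * \<bar>x - y\<bar>"
    "\<And>x. k x - x * g x = h x - (\<integral>z. h z \<partial>std_normal_distribution)"
proof
  define m where "m = (LBINT x. std_normal_density x * h x)"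
  define U where "U w = (LBINT x:{..w}. std_normal_density x * (h x - m))" for w
  define g where "g w = U w / std_normal_density w" for w
  define k where "k w = w * g w + (h w - m)" for w
  note hc = integrable_std_normal_lipschitz[OF h]
  have [measurable]: "h \<in> borel_measurable borel"
    using hc(1) by (rule borel_measurable_continuous_onI)
  have m: "m = (\<integral>z. h z \<partial>std_normal_distribution)"
    unfolding m_def by (subst integral_density) auto
  have pos: "std_normal_density x \<noteq> 0" for x using normal_density_pos[of 1 0 x] by simp
  have "integrable lborel (\<lambda>x. std_normal_density x * h x - std_normal_density x * x ^ 0 * m)"
    by (intro Bochner_Integration.integrable_diff hc integrable_mult_left integrable_std_normal_moment)
  then have "integrable lborel (\<lambda>x. std_normal_density x * (h x - m))"
    by (simp add: right_diff_distrib)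
  then have U: "(U has_real_derivative std_normal_density w * (h w - m)) (at w)" for w
    unfolding U_def by (intro has_derivative_integral_Iic continuous_intros hc)
  show g: "(g has_real_derivative k w) (at w)" for w
    unfolding g_def[abs_def] k_def using pos[of w]
    by (auto intro!: derivative_eq_intros U std_normal_density_has_derivative simp: g_def field_simps)
  show "k x - x * g x = h x - (\<integral>z. h z \<partial>std_normal_distribution)" for x
    unfolding m[symmetric] by (simp add: k_def)
  \<comment> \<open>\<^term>\<open>k\<close> need not be differentiable, but \<^term>\<open>k - h\<close> is, with derivative bounded by 1.\<close>
  have d: "((\<lambda>w. w * g w) has_real_derivative (1 + w\<^sup>2) * g w + w * (h w - m)) (at w)" for w
    by (auto intro!: derivative_eq_intros g simp: k_def algebra_simps power2_eq_square)
  have "\<bar>(1 + w\<^sup>2) * g w + w * (h w - m)\<bar> \<le> 1" for w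
    using stein_solution_bound[OF h, of w] unfolding g_def U_def m_def .
  then have "\<bar>x * g x - y * g y\<bar> \<le> 1 * \<bar>x - y\<bar>" for x y
    using field_differentiable_bound[of UNIV "\<lambda>w. w * g w" "\<lambda>w. (1 + w\<^sup>2) * g w + w * (h w - m)" 1 x y] d
    by auto
  then show "\<bar>k x - k y\<bar> \<le> 2 * \<bar>x - y\<bar>" for x y
    using h[of x y] unfolding k_def by (smt (verit))
qed

section \<open>The L1 distance of distribution functions\<close>

lemma indicator_Ici_diff:
  fixes y z :: real
  shows "integrable lborel (\<lambda>x. indicator {y..} x - indicator {z..} x :: real)"
    "(LBINT x. \<bar>indicator {y..} x - indicator {z..} x :: real\<bar>) = \<bar>y - z\<bar>"
proof -
  have e: "\<bar>indicator {y..} x - indicator {z..} x :: real\<bar> = indicator {min y z..<max y z} x" for x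
    by (auto simp: indicator_def min_def max_def)
  have "integrable lborel (indicator {min y z..<max y z} :: real \<Rightarrow> real)" by simp
  then show "integrable lborel (\<lambda>x. indicator {y..} x - indicator {z..} x :: real)"
    by (rule Bochner_Integration.integrable_bound) (auto simp: e)
  show "(LBINT x. \<bar>indicator {y..} x - indicator {z..} x :: real\<bar>) = \<bar>y - z\<bar>"
    unfolding e by (auto simp: min_def max_def)
qed

text \<open>As a function of \<open>y\<close>, the inner integral is minus the primitive of
  \<open>u\<close> vanishing at 0. Subtracting the indicator of \<open>{0..}\<close> bounds the
  integral of the absolute value by \<open>\<bar>y\<bar>\<close>, which permits Fubini; averaging
  the indicator of \<open>{y..}\<close> over \<open>y\<close> gives the distribution
  function.\<close>

lemma (in real_distribution) integral_primitive:
  fixes u :: "real \<Rightarrow> real"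
  assumes X: "integrable M (\<lambda>x. x)"
    and u[measurable]: "u \<in> borel_measurable borel" and u1: "\<And>x. \<bar>u x\<bar> \<le> 1"
  shows "integrable lborel (\<lambda>x. u x * (cdf M x - indicator {0..} x))"
    "(\<integral>y. (LBINT x. u x * (indicator {y..} x - indicator {0..} x)) \<partial>M)
      = (LBINT x. u x * (cdf M x - indicator {0..} x))"
proof -
  interpret P: pair_sigma_finite M lborel
    by (simp add: pair_sigma_finite_def sigma_finite_measure_axioms sigma_finite_lborel)
  define q :: "real \<Rightarrow> real \<Rightarrow> real" where
    "q y x = u x * (indicator {y..} x - indicator {0..} x)" for y x
  have ind: "indicator {y..} x = (if y \<le> x then 1 else 0 :: real)" for x y :: real
    by (simp add: indicator_def)
  have qm[measurable]: "case_prod q \<in> borel_measurable (M \<Otimes>\<^sub>M lborel)"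
  proof -
    have "case_prod q \<in> borel_measurable (borel \<Otimes>\<^sub>M borel)"
      unfolding q_def ind by measurable
    then show ?thesis by (simp cong: measurable_cong_sets sets_pair_measure_cong)
  qed
  have qb: "\<bar>q y x\<bar> \<le> \<bar>indicator {y..} x - indicator {0..} x\<bar>" for x y
    unfolding q_def abs_mult using u1[of x] by (intro mult_left_le_one_le) auto
  have iq: "integrable lborel (q y)" for y
    using indicator_Ici_diff(1)[of y 0]
    by (rule Bochner_Integration.integrable_bound) (use qb in \<open>auto simp: q_def\<close>)
  have nq: "(LBINT x. norm (q y x)) \<le> \<bar>y\<bar>" for y
  proof -
    have "(LBINT x. norm (q y x)) \<le> (LBINT x. \<bar>indicator {y..} x - indicator {0..} x :: real\<bar>)"
      using qb iq indicator_Ici_diff(1) by (intro integral_mono) auto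
    then show ?thesis using indicator_Ici_diff(2)[of y 0] by simp
  qed
  have int: "integrable (M \<Otimes>\<^sub>M lborel) (case_prod q)"
  proof (rule P.Fubini_integrable)
    show "integrable M (\<lambda>y. LBINT x. norm (case_prod q (y, x)))"
    proof (rule Bochner_Integration.integrable_bound[OF X])
      show "AE y in M. norm (LBINT x. norm (case_prod q (y, x))) \<le> norm y"
        using nq by (auto intro!: AE_I2)
    qed measurable
  qed (use iq in auto)
  have cdf: "(\<integral>y. q y x \<partial>M) = u x * (cdf M x - indicator {0..} x)" for x
  proof -
    have "(\<integral>y. q y x \<partial>M) = (\<integral>y. u x * (indicator {..x} y - indicator {0..} x) \<partial>M)"
      unfolding q_def by (intro Bochner_Integration.integral_cong) (auto simp: indicator_def)
    also have "\<dots> = u x * (cdf M x - indicator {0..} x)"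
      using prob_space by (simp add: cdf_def emeasure_eq_measure)
    finally show ?thesis .
  qed
  show "integrable lborel (\<lambda>x. u x * (cdf M x - indicator {0..} x))"
    using P.integrable_snd[OF int] by (simp add: cdf)
  show "(\<integral>y. (LBINT x. u x * (indicator {y..} x - indicator {0..} x)) \<partial>M)
      = (LBINT x. u x * (cdf M x - indicator {0..} x))"
    using P.Fubini_integral[OF int] by (simp add: cdf) (simp add: q_def)
qed

lemma L1_dist_cdf_le:
  assumes \<mu>: "real_distribution \<mu>" "integrable \<mu> (\<lambda>x. x)"
    and \<nu>: "real_distribution \<nu>" "integrable \<nu> (\<lambda>x. x)"
    and le: "\<And>h. (\<And>x y. \<bar>h x - h y\<bar> \<le> \<bar>x - y\<bar>) \<Longrightarrow> (\<integral>x. h x \<partial>\<mu>) - (\<integral>x. h x \<partial>\<nu>) \<le> C"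
  shows "L1_dist (cdf \<mu>) (cdf \<nu>) \<le> ennreal C"
proof -
  interpret \<mu>: real_distribution \<mu> by fact
  interpret \<nu>: real_distribution \<nu> by fact
  \<comment> \<open>With this sign, \<open>- h\<close> is the primitive of \<open>u\<close>
    vanishing at 0, and it is \<open>- h\<close> that is finally tested in
    \<open>le\<close>.\<close>
  define u where "u x = sgn (cdf \<nu> x - cdf \<mu> x)" for x
  have [measurable]: "cdf \<mu> \<in> borel_measurable borel" "cdf \<nu> \<in> borel_measurable borel"
    by (auto intro!: borel_measurable_mono monoI \<mu>.cdf_nondecreasing \<nu>.cdf_nondecreasing)
  have um[measurable]: "u \<in> borel_measurable borel" unfolding u_def by measurable
  have u1: "\<bar>u x\<bar> \<le> 1" for x by (simp add: u_def sgn_if)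
  define h where "h y = (LBINT x. u x * (indicator {y..} x - indicator {0..} x))" for y
  have int: "integrable lborel (\<lambda>x. u x * (indicator {y..} x - indicator {z..} x))" for y z
    using indicator_Ici_diff(1)[of y z] u1
    by (intro Bochner_Integration.integrable_bound[OF indicator_Ici_diff(1)[of y z]])
      (auto simp: abs_mult intro!: mult_left_le_one_le)
  have lip: "\<bar>h y - h z\<bar> \<le> \<bar>y - z\<bar>" for y z
  proof -
    have "h y - h z = (LBINT x. u x * (indicator {y..} x - indicator {z..} x))"
      unfolding h_def using int
      by (subst Bochner_Integration.integral_diff[symmetric])
        (auto intro!: Bochner_Integration.integral_cong simp: algebra_simps)
    also have "\<bar>\<dots>\<bar> \<le> (LBINT x. \<bar>indicator {y..} x - indicator {z..} x :: real\<bar>)"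
      using indicator_Ici_diff(1)[of y z] u1 integrable_abs[OF int[of y z]]
      by (intro order.trans[OF integral_abs_bound] integral_mono)
        (auto simp: abs_mult intro!: mult_left_le_one_le)
    finally show ?thesis by (simp add: indicator_Ici_diff)
  qed
  note p\<mu> = \<mu>.integral_primitive[OF \<mu>(2) um u1] and p\<nu> = \<nu>.integral_primitive[OF \<nu>(2) um u1]
  have abs: "\<bar>cdf \<mu> x - cdf \<nu> x\<bar> = - (u x * (cdf \<mu> x - indicator {0..} x) - u x * (cdf \<nu> x - indicator {0..} x))" for x
    by (auto simp: u_def sgn_if)
  \<comment> \<open>The indicators cancel in the difference. Integrability lets the extended
    nonnegative distance be computed as a real integral.\<close>
  have i: "integrable lborel (\<lambda>x. \<bar>cdf \<mu> x - cdf \<nu> x\<bar>)"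
    unfolding abs using p\<mu>(1) p\<nu>(1) by auto
  have "(LBINT x. \<bar>cdf \<mu> x - cdf \<nu> x\<bar>) = - ((\<integral>x. h x \<partial>\<mu>) - (\<integral>x. h x \<partial>\<nu>))"
    unfolding abs h_def p\<mu>(2) p\<nu>(2) using p\<mu>(1) p\<nu>(1) by simp
  also have "\<dots> = (\<integral>x. - h x \<partial>\<mu>) - (\<integral>x. - h x \<partial>\<nu>)" by simp
  also have "\<dots> \<le> C" using lip by (intro le) (simp add: abs_minus_commute)
  finally show ?thesis
    unfolding L1_dist_def using i by (simp add: nn_integral_eq_integral ennreal_leI)
qed

section \<open>Normal approximation of sums\<close>

lemma (in prob_space) L1_dist_sum_std_normal:
  fixes X :: "'i \<Rightarrow> 'a \<Rightarrow> real"
  assumes I: "finite I" and indep: "indep_vars (\<lambda>_. borel) X I"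
    and X: "\<And>i. i \<in> I \<Longrightarrow> integrable M (\<lambda>x. \<bar>X i x\<bar> ^ 3)" "\<And>i. i \<in> I \<Longrightarrow> expectation (X i) = 0"
    and var: "(\<Sum>i\<in>I. expectation (\<lambda>x. (X i x)\<^sup>2)) = 1"
  shows "L1_dist (cdf (distr M borel (\<lambda>x. \<Sum>i\<in>I. X i x))) (cdf std_normal_distribution)
    \<le> ennreal (\<Sum>i\<in>I. expectation (\<lambda>x. \<bar>X i x\<bar> ^ 3))"
proof (rule L1_dist_cdf_le)
  have rv: "X i \<in> borel_measurable M" if "i \<in> I" for i
    using indep that unfolding indep_vars_def by blast
  define W where "W x = (\<Sum>i\<in>I. X i x)" for x
  have W[measurable]: "W \<in> borel_measurable M"
    unfolding W_def[abs_def] using rv by (intro borel_measurable_sum) auto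
  have W3: "integrable M (\<lambda>x. \<bar>W x\<bar> ^ 3)"
    unfolding W_def using I rv X(1) by (intro integrable_abs_sum_cube) auto
  have Wle: "\<bar>W x\<bar> \<le> 1 + \<bar>W x\<bar> ^ 3" for x
    using power_le_one_plus_cube[of "\<bar>W x\<bar>" 1] by simp
  show "real_distribution (distr M borel (\<lambda>x. \<Sum>i\<in>I. X i x))"
    unfolding W_def[symmetric] by simp
  have "integrable M W" using Wle by (intro integrable_cubic_growth[OF W W W3, of 1]) auto
  then show "integrable (distr M borel (\<lambda>x. \<Sum>i\<in>I. X i x)) (\<lambda>x. x)"
    unfolding W_def[symmetric] by (simp add: integrable_distr_eq)
  show "real_distribution std_normal_distribution" by (rule real_dist_normal_dist)
  show "integrable std_normal_distribution (\<lambda>x. x)"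
    using integrable_std_normal_distribution_moment[of 1] by simp
  fix h :: "real \<Rightarrow> real" assume h: "\<bar>h x - h y\<bar> \<le> \<bar>x - y\<bar>" for x y
  obtain g k :: "real \<Rightarrow> real" where
    gk: "\<And>x. (g has_real_derivative k x) (at x)" "\<And>x y. \<bar>k x - k y\<bar> \<le> 2 * \<bar>x - y\<bar>"
    and eq: "\<And>x. k x - x * g x = h x - (\<integral>z. h z \<partial>std_normal_distribution)"
    using stein_equation_lipschitz[OF h] by blast
  have [measurable]: "h \<in> borel_measurable borel"
    using integrable_std_normal_lipschitz(1)[OF h] by (rule borel_measurable_continuous_onI)
  have hW: "integrable M (\<lambda>x. h (W x))"
  proof (rule integrable_cubic_growth[OF W _ W3])
    fix x
    have "\<bar>h (W x)\<bar> \<le> \<bar>h 0\<bar> * 1 + 1 * \<bar>W x\<bar>" using h[of "W x" 0] by simp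
    also have "\<dots> \<le> \<bar>h 0\<bar> * (1 + \<bar>W x\<bar> ^ 3) + 1 * (1 + \<bar>W x\<bar> ^ 3)"
      using Wle by (intro add_mono mult_left_mono) auto
    finally show "\<bar>h (W x)\<bar> \<le> (\<bar>h 0\<bar> + 1) * (1 + \<bar>W x\<bar> ^ 3)" by (simp only: distrib_right)
  qed measurable
  have "(\<integral>x. h x \<partial>distr M borel (\<lambda>x. \<Sum>i\<in>I. X i x)) - (\<integral>x. h x \<partial>std_normal_distribution)
      = expectation (\<lambda>x. h (W x)) - (\<integral>x. h x \<partial>std_normal_distribution)"
    unfolding W_def[symmetric] by (subst integral_distr) auto
  also have "\<dots> = expectation (\<lambda>x. k (W x) - W x * g (W x))"
    unfolding eq using hW prob_space by simp
  \<comment> \<open>The Lipschitz constant 2 of \<open>k\<close> cancels the factor one half of the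
    Stein bound, which gives the constant 1.\<close>
  also have "\<dots> \<le> 2 / 2 * (\<Sum>i\<in>I. expectation (\<lambda>x. \<bar>X i x\<bar> ^ 3))"
    unfolding W_def by (rule stein_bound_sum[OF I indep X var gk])
  finally show "(\<integral>x. h x \<partial>distr M borel (\<lambda>x. \<Sum>i\<in>I. X i x)) - (\<integral>x. h x \<partial>std_normal_distribution)
      \<le> (\<Sum>i\<in>I. expectation (\<lambda>x. \<bar>X i x\<bar> ^ 3))" by simp
qed

text \<open>Scaling every summand by \<open>1 / \<sigma>\<close> makes the total variance 1 and
  multiplies third absolute moments by \<open>1 / \<sigma> ^ 3\<close>.\<close>

lemma (in prob_space) L1_dist_normalized_sum:
  fixes X :: "'i \<Rightarrow> 'a \<Rightarrow> real"
  assumes I: "finite I" and indep: "indep_vars (\<lambda>_. borel) X I"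
    and X: "\<And>i. i \<in> I \<Longrightarrow> distr M borel (X i) \<in> mean_zero_class (s i)"
    and \<sigma>: "\<sigma> > 0" "\<sigma>\<^sup>2 = (\<Sum>i\<in>I. (s i)\<^sup>2)"
  shows "L1_dist (cdf (distr M borel (\<lambda>x. 1 / \<sigma> * (\<Sum>i\<in>I. X i x)))) (cdf std_normal_distribution)
    \<le> ennreal (1 / \<sigma> ^ 3 * (\<Sum>i\<in>I. expectation (\<lambda>x. \<bar>X i x\<bar> ^ 3)))"
proof -
  have rv: "X i \<in> borel_measurable M" if "i \<in> I" for i
    using indep that unfolding indep_vars_def by blast
  have m: "integrable M (\<lambda>x. \<bar>X i x\<bar> ^ 3)" "expectation (X i) = 0"
      "expectation (\<lambda>x. (X i x)\<^sup>2) = (s i)\<^sup>2" if "i \<in> I" for i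
    using X[OF that] rv[OF that] by (auto simp: mean_zero_class_def integrable_distr_eq integral_distr)
  define Y where "Y i x = 1 / \<sigma> * X i x" for i x
  have c: "(\<lambda>x. \<bar>Y i x\<bar> ^ 3) = (\<lambda>x. 1 / \<sigma> ^ 3 * \<bar>X i x\<bar> ^ 3)" for i
    using \<sigma> by (simp add: Y_def abs_mult power_mult_distrib power_divide)
  have sq: "(Y i x)\<^sup>2 = 1 / \<sigma>\<^sup>2 * (X i x)\<^sup>2" for i x
    by (simp add: Y_def power_divide)
  have "L1_dist (cdf (distr M borel (\<lambda>x. \<Sum>i\<in>I. Y i x))) (cdf std_normal_distribution)
      \<le> ennreal (\<Sum>i\<in>I. expectation (\<lambda>x. \<bar>Y i x\<bar> ^ 3))"
  proof (rule L1_dist_sum_std_normal[OF I])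
    show "indep_vars (\<lambda>_. borel) Y I"
      unfolding Y_def[abs_def] using indep_vars_compose2[OF indep, of "\<lambda>_ x. 1 / \<sigma> * x"] by simp
    show "integrable M (\<lambda>x. \<bar>Y i x\<bar> ^ 3)" if "i \<in> I" for i
      unfolding c using m[OF that] by simp
    show "expectation (Y i) = 0" if "i \<in> I" for i
      unfolding Y_def[abs_def] using m(2)[OF that] by simp
    have "(\<Sum>i\<in>I. expectation (\<lambda>x. (Y i x)\<^sup>2)) = (\<Sum>i\<in>I. 1 / \<sigma>\<^sup>2 * (s i)\<^sup>2)"
      using m(3) by (intro sum.cong) (simp_all add: sq)
    also have "\<dots> = 1 / \<sigma>\<^sup>2 * \<sigma>\<^sup>2" unfolding \<sigma>(2) by (simp add: sum_distrib_left)
    finally show "(\<Sum>i\<in>I. expectation (\<lambda>x. (Y i x)\<^sup>2)) = 1" using \<sigma>(1) by simp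
  qed
  moreover have "(\<Sum>i\<in>I. expectation (\<lambda>x. \<bar>Y i x\<bar> ^ 3))
      = 1 / \<sigma> ^ 3 * (\<Sum>i\<in>I. expectation (\<lambda>x. \<bar>X i x\<bar> ^ 3))"
    unfolding c sum_distrib_left by simp
  ultimately show ?thesis by (simp only: Y_def sum_distrib_left)
qed

theorem theorem1p1:
  fixes M :: "'a measure"
  assumes "prob_space M"
  shows
    "(\<forall>(n::nat) (X :: nat \<Rightarrow> 'a \<Rightarrow> real) (G :: nat \<Rightarrow> real measure) (s :: nat \<Rightarrow> real) (\<sigma>::real).
        n \<ge> 1 \<longrightarrow>
        prob_space.indep_vars M (\<lambda>_. borel) X {1..n} \<longrightarrow>
        (\<forall>i\<in>{1..n}. s i > 0 \<and> G i \<in> mean_zero_class (s i) \<and> distr M borel (X i) = G i) \<longrightarrow>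
        \<sigma> > 0 \<longrightarrow> \<sigma>\<^sup>2 = (\<Sum>i=1..n. (s i)\<^sup>2) \<longrightarrow>
        L1_dist (cdf (distr M borel (\<lambda>\<omega>. 1 / \<sigma> * (\<Sum>i=1..n. X i \<omega>)))) (cdf std_normal_distribution)
          \<le> ennreal (1 / \<sigma> ^ 3 * (\<Sum>i=1..n. prob_space.expectation M (\<lambda>\<omega>. \<bar>X i \<omega>\<bar> ^ 3))))
     \<and>
     (\<forall>(X :: nat \<Rightarrow> 'a \<Rightarrow> real) (G :: real measure) (\<sigma>::real).
        prob_space.indep_vars M (\<lambda>_. borel) X {1..} \<longrightarrow>
        \<sigma> > 0 \<longrightarrow> G \<in> mean_zero_class \<sigma> \<longrightarrow>
        (\<forall>i\<ge>1. distr M borel (X i) = G) \<longrightarrow>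
        (\<forall>n::nat. n \<ge> 1 \<longrightarrow>
          L1_dist (cdf (distr M borel (\<lambda>\<omega>. (\<Sum>i=1..n. X i \<omega>) / (\<sigma> * sqrt (real n)))))
                  (cdf std_normal_distribution)
            \<le> ennreal (prob_space.expectation M (\<lambda>\<omega>. \<bar>X 1 \<omega>\<bar> ^ 3) / (\<sigma> ^ 3 * sqrt (real n)))))"
proof -
  interpret prob_space M by fact
  show ?thesis
  proof (intro conjI allI impI)
    fix n :: nat and X :: "nat \<Rightarrow> 'a \<Rightarrow> real" and G :: "nat \<Rightarrow> real measure"
      and s :: "nat \<Rightarrow> real" and \<sigma> :: real
    assume "indep_vars (\<lambda>_. borel) X {1..n}"
      "\<forall>i\<in>{1..n}. s i > 0 \<and> G i \<in> mean_zero_class (s i) \<and> distr M borel (X i) = G i"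
      "\<sigma> > 0" "\<sigma>\<^sup>2 = (\<Sum>i=1..n. (s i)\<^sup>2)"
    then show "L1_dist (cdf (distr M borel (\<lambda>\<omega>. 1 / \<sigma> * (\<Sum>i=1..n. X i \<omega>)))) (cdf std_normal_distribution)
        \<le> ennreal (1 / \<sigma> ^ 3 * (\<Sum>i=1..n. expectation (\<lambda>\<omega>. \<bar>X i \<omega>\<bar> ^ 3)))"
      by (intro L1_dist_normalized_sum[where s=s]) auto
  next
    fix X :: "nat \<Rightarrow> 'a \<Rightarrow> real" and G :: "real measure" and \<sigma> :: real and n :: nat
    assume indep: "indep_vars (\<lambda>_. borel) X {1..}" and \<sigma>: "\<sigma> > 0" and G: "G \<in> mean_zero_class \<sigma>"
      and X: "\<forall>i\<ge>1. distr M borel (X i) = G" and n: "n \<ge> 1"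
    have rv: "X i \<in> borel_measurable M" if "i \<ge> 1" for i
      using indep that unfolding indep_vars_def by auto
    have e: "expectation (\<lambda>\<omega>. \<bar>X i \<omega>\<bar> ^ 3) = (\<integral>x. \<bar>x\<bar> ^ 3 \<partial>G)" if "i \<ge> 1" for i
      using X that rv[OF that] integral_distr[of "X i" M borel "\<lambda>x. \<bar>x\<bar> ^ 3"] by auto
    \<comment> \<open>The total variance is \<open>n * \<sigma>^2\<close>, so
      \<open>\<sigma> * sqrt n\<close> takes the place of \<open>\<sigma>\<close>. Of the factor
      \<open>sqrt n ^ 3 = n * sqrt n\<close>, the part \<open>n\<close> cancels against the
      \<open>n\<close> equal moments.\<close>
    have "L1_dist (cdf (distr M borel (\<lambda>\<omega>. 1 / (\<sigma> * sqrt n) * (\<Sum>i=1..n. X i \<omega>)))) (cdf std_normal_distribution)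
        \<le> ennreal (1 / (\<sigma> * sqrt n) ^ 3 * (\<Sum>i=1..n. expectation (\<lambda>\<omega>. \<bar>X i \<omega>\<bar> ^ 3)))"
      using indep_vars_subset[OF indep, of "{1..n}"] X G \<sigma> n
      by (intro L1_dist_normalized_sum[where s="\<lambda>_. \<sigma>"]) (auto simp: power_mult_distrib)
    moreover have "(\<Sum>i=1..n. expectation (\<lambda>\<omega>. \<bar>X i \<omega>\<bar> ^ 3)) = real n * expectation (\<lambda>\<omega>. \<bar>X 1 \<omega>\<bar> ^ 3)"
      by (simp add: e)
    moreover have "1 / (\<sigma> * sqrt n) ^ 3 * (real n * a) = a / (\<sigma> ^ 3 * sqrt n)" for a
    proof -
      have "sqrt n ^ 3 = real n * sqrt n" by (simp add: power3_eq_cube)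
      then show ?thesis using n \<sigma> by (simp add: power_mult_distrib field_simps)
    qed
    ultimately show "L1_dist (cdf (distr M borel (\<lambda>\<omega>. (\<Sum>i=1..n. X i \<omega>) / (\<sigma> * sqrt (real n)))))
        (cdf std_normal_distribution)
        \<le> ennreal (expectation (\<lambda>\<omega>. \<bar>X 1 \<omega>\<bar> ^ 3) / (\<sigma> ^ 3 * sqrt (real n)))"
      by simp
  qed
qed

end
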